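(* Let $\mathcal{X}\subset\mathbb{R}^n$ (state set) and $\mathcal{U}\subset\mathbb{R}^m$ (input set) be hybrid zonotopes, let $\mathbf{f}$ be a (nonlinear) function with values in $\mathbb{R}^n$ defined on $\mathcal{X}\times\mathcal{U}$, and let $\boldsymbol{\pi}$ be a ReLU-activated feed-forward neural network with $\boldsymbol{\pi}(\mathbf{x})\in\mathcal{U}$ for all $\mathbf{x}\in\mathcal{X}$. Let $\mathcal{H}_\pi=\langle \mathbf{G}^c_\pi,\mathbf{G}^b_\pi,\mathbf{c}_\pi,\mathbf{A}^c_\pi,\mathbf{A}^b_\pi,\mathbf{b}_\pi\rangle\subset\mathbb{R}^{n+m}$ be a hybrid zonotope equal to the graph set of $\boldsymbol{\pi}$ over $\mathcal{X}$, i.e. $\mathcal{H}_\pi=\{[\mathbf{x}^\top\ \mathbf{u}^\top]^\top\mid \mathbf{u}=\boldsymbol{\pi}(\mathbf{x}),\ \mathbf{x}\in\mathcal{X}\}$. Let $\overline{\mathcal{H}}_f(\mathcal{X},\mathcal{U})=\langle \mathbf{G}^c_f,\mathbf{G}^b_f,\mathbf{c}_f,\mathbf{A}^c_f,\mathbf{A}^b_f,\mathbf{b}_f\rangle\subset\mathbb{R}^{2n+m}$ be a hybrid zonotope envelope of $\mathbf{f}$, i.e. $\overline{\mathcal{H}}_f(\mathcal{X},\mathcal{U})\supseteq\mathcal{G}_f(\mathcal{X},\mathcal{U})=\{[\mathbf{x}^\top\ \mathbf{u}^\top\ \mathbf{y}^\top]^\top\mid \mathbf{y}=\mathbf{f}(\mathbf{x},\mathbf{u}),\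 \mathbf{x}\in\mathcal{X},\ \mathbf{u}\in\mathcal{U}\}$. Let $\mathcal{T}=\langle \mathbf{G}^c_\tau,\mathbf{G}^b_\tau,\mathbf{c}_\tau,\mathbf{A}^c_\tau,\mathbf{A}^b_\tau,\mathbf{b}_\tau\rangle\subset\mathbb{R}^n$ be a target set represented by a hybrid zonotope. Then the hybrid zonotope $$\overline{\mathcal{P}}(\mathcal{T})=\langle \mathbf{G}^c_p,\mathbf{G}^b_p,\mathbf{c}_p,\mathbf{A}^c_p,\mathbf{A}^b_p,\mathbf{b}_p\rangle$$ is an over-approximation of the one-step backward reachable set of the closed-loop system $\mathbf{x}(t+1)=\mathbf{f}(\mathbf{x}(t),\boldsymbol{\pi}(\mathbf{x}(t)))$, i.e. $\mathcal{P}(\mathcal{T})\subseteq\overline{\mathcal{P}}(\mathcal{T})$, where $\mathbf{c}_p=\mathbf{c}_\pi[1:n,:]$, $\mathbf{G}^c_p=\begin{bmatrix}\mathbf{G}^c_\pi[1:n,:]&\mathbf{0}&\mathbf{0}\end{bmatrix}$, $\mathbf{G}^b_p=\begin{bmatrix}\mathbf{G}^b_\pi[1:n,:]&\mathbf{0}&\mathbf{0}\end{bmatrix}$ and $$\mathbf{A}^c_p=\begin{bmatrix}\mathbf{A}^c_\pi&\mathbf{0}&\mathbf{0}\\ \mathbf{0}&\mathbf{A}^c_f&\mathbf{0}\\ \mathbf{0}&\mathbf{0}&\mathbf{A}^c_\tau\\ \mathbf{G}^c_\pi&-\mathbf{G}^c_f[1:n+m,:]&\mathbf{0}\\ \mathbf{0}&\mathbf{G}^c_f[n+m+1:2n+m,:]&-\mathbf{G}^c_\tau\end{bmatrix},$$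 $$\mathbf{A}^b_p=\begin{bmatrix}\mathbf{A}^b_\pi&\mathbf{0}&\mathbf{0}\\ \mathbf{0}&\mathbf{A}^b_f&\mathbf{0}\\ \mathbf{0}&\mathbf{0}&\mathbf{A}^b_\tau\\ \mathbf{G}^b_\pi&-\mathbf{G}^b_f[1:n+m,:]&\mathbf{0}\\ \mathbf{0}&\mathbf{G}^b_f[n+m+1:2n+m,:]&-\mathbf{G}^b_\tau\end{bmatrix},\qquad \mathbf{b}_p=\begin{bmatrix}\mathbf{b}_\pi\\ \mathbf{b}_f\\ \mathbf{b}_\tau\\ \mathbf{c}_f[1:n+m,:]-\mathbf{c}_\pi\\ \mathbf{c}_\tau-\mathbf{c}_f[n+m+1:2n+m,:]\end{bmatrix}.$$
   Context: Hybrid zonotope: for $\mathbf{c}\in\mathbb{R}^{d}$, $\mathbf{G}^c\in\mathbb{R}^{d\times n_g}$, $\mathbf{G}^b\in\mathbb{R}^{d\times n_b}$, $\mathbf{A}^c\in\mathbb{R}^{n_c\times n_g}$, $\mathbf{A}^b\in\mathbb{R}^{n_c\times n_b}$, $\mathbf{b}\in\mathbb{R}^{n_c}$, $$\langle \mathbf{G}^c,\mathbf{G}^b,\mathbf{c},\mathbf{A}^c,\mathbf{A}^b,\mathbf{b}\rangle=\{\mathbf{G}^c\boldsymbol{\xi}^c+\mathbf{G}^b\boldsymbol{\xi}^b+\mathbf{c}\mid \boldsymbol{\xi}^c\in[-1,1]^{n_g},\ \boldsymbol{\xi}^b\in\{-1,1\}^{n_b},\ \mathbf{A}^c\boldsymbol{\xi}^c+\mathbf{A}^b\boldsymbol{\xi}^b=\mathbf{b}\}\subset\mathbb{R}^d.$$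 A set is a hybrid zonotope if it is of this form (the numbers $n_g,n_b,n_c$ may differ from one hybrid zonotope to another). One-step backward reachable set: $\mathcal{P}(\mathcal{T})=\{\mathbf{x}\in\mathcal{X}\mid \mathbf{f}(\mathbf{x},\boldsymbol{\pi}(\mathbf{x}))\in\mathcal{T}\}$. Feed-forward neural network with $\ell$ layers, weights $\mathbf{W}^{(k-1)}$ and biases $\mathbf{v}^{(k-1)}$ ($k=1,\dots,\ell$): $\mathbf{x}^{(0)}=\mathbf{x}$, $\mathbf{x}^{(k)}=\boldsymbol{\phi}(\mathbf{W}^{(k-1)}\mathbf{x}^{(k-1)}+\mathbf{v}^{(k-1)})$ for $k=1,\dots,\ell-1$, and $\boldsymbol{\pi}(\mathbf{x})=\mathbf{W}^{(\ell-1)}\mathbf{x}^{(\ell-1)}+\mathbf{v}^{(\ell-1)}$, where $\boldsymbol{\phi}$ applies the scalar activation $\sigma$ componentwise; ReLU-activated means $\sigma(x)=\max(x,0)$. Notation: $\mathbf{A}[i:j,:]$ is the submatrix of rows $i$ through $j$ of $\mathbf{A}$ (also used for column vectors); $\mathbf{0}$ is a zero matrix of compatible size. *)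

theory Defs
  imports "Jordan_Normal_Form.Matrix"
begin

definition append_cols :: "'a :: zero mat \<Rightarrow> 'a mat \<Rightarrow> 'a mat" (infixr \<open>@\<^sub>c\<close> 66) where
  "A @\<^sub>c B = four_block_mat A B (0\<^sub>m 0 (dim_col A)) (0\<^sub>m 0 (dim_col B))"

text \<open>Rows (entries) \<open>i\<close> through \<open>j\<close> are counted from 1 and both ends are included, whereas
  the indices of the types \<^typ>\<open>'a mat\<close> and \<^typ>\<open>'a vec\<close> start at 0.\<close>

definition rows_between :: "nat \<Rightarrow> nat \<Rightarrow> 'a mat \<Rightarrow> 'a mat" where
  "rows_between i j A = mat (j + 1 - i) (dim_col A) (\<lambda>(r, s). A $$ (i - 1 + r, s))"

definition entries_between :: "nat \<Rightarrow> nat \<Rightarrow> 'a vec \<Rightarrow> 'a vec" where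
  "entries_between i j v = vec (j + 1 - i) (\<lambda>r. v $ (i - 1 + r))"

definition hz_carrier ::
  "nat \<Rightarrow> nat \<Rightarrow> nat \<Rightarrow> nat \<Rightarrow>
   real mat \<Rightarrow> real mat \<Rightarrow> real vec \<Rightarrow> real mat \<Rightarrow> real mat \<Rightarrow> real vec \<Rightarrow> bool" where
  "hz_carrier d ng nb nc Gc Gb c Ac Ab b \<longleftrightarrow>
     Gc \<in> carrier_mat d ng \<and> Gb \<in> carrier_mat d nb \<and> c \<in> carrier_vec d \<and>
     Ac \<in> carrier_mat nc ng \<and> Ab \<in> carrier_mat nc nb \<and> b \<in> carrier_vec nc"

text \<open>Meaningful only for data that satisfy \<^const>\<open>hz_carrier\<close>.\<close>

definition hybrid_zonotope ::
  "real mat \<Rightarrow> real mat \<Rightarrow> real vec \<Rightarrow> real mat \<Rightarrow> real mat \<Rightarrow> real vec \<Rightarrow> real vec set" where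
  "hybrid_zonotope Gc Gb c Ac Ab b =
     {Gc *\<^sub>v \<xi>c + Gb *\<^sub>v \<xi>b + c | \<xi>c \<xi>b.
        \<xi>c \<in> carrier_vec (dim_col Gc) \<and> (\<forall>i < dim_col Gc. \<xi>c $ i \<in> {-1..1}) \<and>
        \<xi>b \<in> carrier_vec (dim_col Gb) \<and> (\<forall>i < dim_col Gb. \<xi>b $ i \<in> {-1, 1}) \<and>
        Ac *\<^sub>v \<xi>c + Ab *\<^sub>v \<xi>b = b}"

definition is_hybrid_zonotope :: "nat \<Rightarrow> real vec set \<Rightarrow> bool" where
  "is_hybrid_zonotope d S \<longleftrightarrow>
     (\<exists>ng nb nc Gc Gb c Ac Ab b. hz_carrier d ng nb nc Gc Gb c Ac Ab b \<and>
        S = hybrid_zonotope Gc Gb c Ac Ab b)"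

definition relu :: "real \<Rightarrow> real" where
  "relu x = max x 0"

text \<open>\<open>W k\<close> and \<open>v k\<close> are the weight matrix and the bias leading from layer \<open>k\<close> to
  layer \<open>k + 1\<close>; only their values for \<open>k < l\<close> matter in a network with \<open>l\<close> layers.\<close>

fun nn_layer ::
  "(real \<Rightarrow> real) \<Rightarrow> (nat \<Rightarrow> real mat) \<Rightarrow> (nat \<Rightarrow> real vec) \<Rightarrow> nat \<Rightarrow> real vec \<Rightarrow> real vec" where
  "nn_layer \<sigma> W v 0 x = x"
| "nn_layer \<sigma> W v (Suc k) x = map_vec \<sigma> (W k *\<^sub>v nn_layer \<sigma> W v k x + v k)"

definition nn_output ::
  "(real \<Rightarrow> real) \<Rightarrow> nat \<Rightarrow> (nat \<Rightarrow> real mat) \<Rightarrow> (nat \<Rightarrow> real vec) \<Rightarrow> real vec \<Rightarrow> real vec" where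
  "nn_output \<sigma> l W v x = W (l - 1) *\<^sub>v nn_layer \<sigma> W v (l - 1) x + v (l - 1)"

definition nn_carrier ::
  "nat \<Rightarrow> nat \<Rightarrow> nat \<Rightarrow> (nat \<Rightarrow> real mat) \<Rightarrow> (nat \<Rightarrow> real vec) \<Rightarrow> bool" where
  "nn_carrier n m l W v \<longleftrightarrow>
     1 \<le> l \<and>
     (\<exists>d :: nat \<Rightarrow> nat. d 0 = n \<and> d l = m \<and>
        (\<forall>k < l. W k \<in> carrier_mat (d (k + 1)) (d k) \<and> v k \<in> carrier_vec (d (k + 1))))"

definition controller_graph :: "(real vec \<Rightarrow> real vec) \<Rightarrow> real vec set \<Rightarrow> real vec set" where
  "controller_graph \<pi> X = {x @\<^sub>v u | x u. u = \<pi> x \<and> x \<in> X}"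

definition dynamics_graph ::
  "(real vec \<Rightarrow> real vec \<Rightarrow> real vec) \<Rightarrow> real vec set \<Rightarrow> real vec set \<Rightarrow> real vec set" where
  "dynamics_graph f X U = {x @\<^sub>v u @\<^sub>v y | x u y. y = f x u \<and> x \<in> X \<and> u \<in> U}"

definition backward_reach ::
  "real vec set \<Rightarrow> (real vec \<Rightarrow> real vec \<Rightarrow> real vec) \<Rightarrow> (real vec \<Rightarrow> real vec) \<Rightarrow>
   real vec set \<Rightarrow> real vec set" where
  "backward_reach X f \<pi> T = {x \<in> X. f x (\<pi> x) \<in> T}"

end

theory Submission
  imports Defs
begin

text \<open>A member \<open>x\<close> of the backward reachable set comes with three points: \<open>x @\<^sub>v u\<close> in the graph
  of the controller (where \<open>u = \<pi> x\<close>), \<open>x @\<^sub>v u @\<^sub>v y\<close> in the graph of the dynamics, hence in its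
  envelope (where \<open>y = f x u\<close>), and \<open>y\<close> in the target set. Each of them is
  parametrised by continuous and binary factors of its own zonotope. The concatenated factors
  are factors of the new zonotope: the first three block rows of its constraints are
  the constraints of the three zonotopes, and the last two express that the
  parametrised points share the coordinates \<open>(x, u)\<close> and \<open>y\<close>, respectively. The generators of the
  new zonotope read \<open>x\<close> off the first point and ignore the other factors.

  Thus the new zonotope is the projection to the state coordinates of the points \<open>(x, u, y)\<close> of
  the envelope with \<open>(x, u)\<close> in the controller graph and \<open>y\<close> in the target set. Points of the
  envelope outside the graph of the dynamics are what may make it larger than the backward
  reachable set. The action of the constraint matrix on concatenated
  factors is \<open>coupled_rows_mult_vec\<close>, the slicing of a parametrised point into coordinates is
  \<open>entries_between_affine\<close>, and \<open>coupling_of_equal_points\<close> turns the equality of two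
  parametrised points into a coupling row.\<close>

section \<open>Block matrices applied to concatenated vectors\<close>

lemma append_cols_carrier [simp, intro]:
  assumes "A \<in> carrier_mat r a" and "B \<in> carrier_mat r b"
  shows "A @\<^sub>c B \<in> carrier_mat r (a + b)"
  using assms by (auto simp: append_cols_def)

lemma append_cols_mult_vec:
  fixes A B :: "'a :: comm_semiring_0 mat"
  assumes A: "A \<in> carrier_mat r a" and B: "B \<in> carrier_mat r b"
    and x: "x \<in> carrier_vec a" and y: "y \<in> carrier_vec b"
  shows "(A @\<^sub>c B) *\<^sub>v (x @\<^sub>v y) = A *\<^sub>v x + B *\<^sub>v y"
proof (rule eq_vecI)
  show "dim_vec ((A @\<^sub>c B) *\<^sub>v (x @\<^sub>v y)) = dim_vec (A *\<^sub>v x + B *\<^sub>v y)"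
    using A B by (simp add: append_cols_def)
  fix i assume "i < dim_vec (A *\<^sub>v x + B *\<^sub>v y)"
  then have i: "i < r" using B by simp
  have "row (A @\<^sub>c B) i = row A i @\<^sub>v row B i"
    unfolding append_cols_def using A B i
    by (subst row_four_block_mat(1)[where ?nr1.0 = r and ?nc1.0 = a and ?nr2.0 = 0 and ?nc2.0 = b]) auto
  then show "((A @\<^sub>c B) *\<^sub>v (x @\<^sub>v y)) $ i = (A *\<^sub>v x + B *\<^sub>v y) $ i"
    using A B x y i by (simp add: append_cols_def scalar_prod_append[of _ a _ b])
qed

lemma append_cols3_mult_vec:
  fixes A B C :: "'a :: comm_semiring_0 mat"
  assumes "A \<in> carrier_mat r a" "B \<in> carrier_mat r b" "C \<in> carrier_mat r c"
    and "x \<in> carrier_vec a" "y \<in> carrier_vec b" "z \<in> carrier_vec c"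
  shows "(A @\<^sub>c B @\<^sub>c C) *\<^sub>v (x @\<^sub>v y @\<^sub>v z) = A *\<^sub>v x + (B *\<^sub>v y + C *\<^sub>v z)"
  using assms
  by (simp add: append_cols_mult_vec[where r = r and a = a and b = "b + c"]
      append_cols_mult_vec[where r = r and a = b and b = c])

lemma zero_mat_mult_vec:
  fixes x :: "'a :: semiring_0 vec"
  assumes "x \<in> carrier_vec a"
  shows "0\<^sub>m r a *\<^sub>v x = 0\<^sub>v r"
  using assms by (intro eq_vecI) auto

lemma append_vec_add5:
  assumes "dim_vec p1 = dim_vec q1" "dim_vec p2 = dim_vec q2" "dim_vec p3 = dim_vec q3"
    and "dim_vec p4 = dim_vec q4" "dim_vec p5 = dim_vec q5"
  shows "(p1 @\<^sub>v p2 @\<^sub>v p3 @\<^sub>v p4 @\<^sub>v p5) + (q1 @\<^sub>v q2 @\<^sub>v q3 @\<^sub>v q4 @\<^sub>v q5) =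
    (p1 + q1) @\<^sub>v (p2 + q2) @\<^sub>v (p3 + q3) @\<^sub>v (p4 + q4) @\<^sub>v (p5 + q5)"
  using assms by (intro eq_vecI) auto

section \<open>Slices of parametrised points\<close>

lemma rows_between_mult_vec:
  assumes A: "A \<in> carrier_mat d a" and i: "1 \<le> i" and j: "j \<le> d"
  shows "rows_between i j A *\<^sub>v x = entries_between i j (A *\<^sub>v x)"
proof (rule eq_vecI)
  show "dim_vec (rows_between i j A *\<^sub>v x) = dim_vec (entries_between i j (A *\<^sub>v x))"
    by (simp add: rows_between_def entries_between_def)
  fix r assume "r < dim_vec (entries_between i j (A *\<^sub>v x))"
  then have r: "r < j + 1 - i" by (simp add: entries_between_def)
  then have "i - 1 + r < d" using i j by simp
  moreover from this r A have "row (rows_between i j A) r = row A (i - 1 + r)"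
    by (intro eq_vecI) (auto simp: rows_between_def)
  ultimately show "(rows_between i j A *\<^sub>v x) $ r = entries_between i j (A *\<^sub>v x) $ r"
    using r A by (simp add: rows_between_def entries_between_def)
qed

lemma entries_between_affine:
  assumes "G \<in> carrier_mat d a" and "H \<in> carrier_mat d b" and "c \<in> carrier_vec d"
    and "1 \<le> i" and "j \<le> d"
  shows "entries_between i j (G *\<^sub>v x + H *\<^sub>v y + c) =
    rows_between i j G *\<^sub>v x + rows_between i j H *\<^sub>v y + entries_between i j c"
  using assms
  by (intro eq_vecI) (auto simp: rows_between_mult_vec[where d = d] entries_between_def add.assoc)

lemma entries_between_append_left:
  assumes "x \<in> carrier_vec k"
  shows "entries_between 1 k (x @\<^sub>v y) = x"
  using assms by (intro eq_vecI) (auto simp: entries_between_def)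

lemma entries_between_append_right:
  assumes "x \<in> carrier_vec k" and "y \<in> carrier_vec l"
  shows "entries_between (k + 1) (l + k) (x @\<^sub>v y) = y"
  using assms by (intro eq_vecI) (auto simp: entries_between_def)

lemma append_vec_assoc: "(x @\<^sub>v y) @\<^sub>v z = x @\<^sub>v y @\<^sub>v z"
  by (intro eq_vecI) auto

section \<open>Coupling three systems of linear constraints\<close>

text \<open>The constraints on the continuous and on the binary factors have the same block pattern:
  three independent systems, a coupling of the first with the second, and a coupling of the
  second with the third. One lemma therefore serves both matrices. The variables \<open>P\<close>, \<open>Q\<close> stand
  for the generators of the two descriptions of \<open>(x, u)\<close>, and \<open>R\<close>, \<open>S\<close> for those of \<open>y\<close>.\<close>

lemma coupled_rows_mult_vec:
  fixes A B C P Q R S :: "'a :: comm_ring_1 mat"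
  assumes A: "A \<in> carrier_mat r1 a" and B: "B \<in> carrier_mat r2 b" and C: "C \<in> carrier_mat r3 c"
    and P: "P \<in> carrier_mat r4 a" and Q: "Q \<in> carrier_mat r4 b"
    and R: "R \<in> carrier_mat r5 b" and S: "S \<in> carrier_mat r5 c"
    and x: "x \<in> carrier_vec a" and y: "y \<in> carrier_vec b" and z: "z \<in> carrier_vec c"
  shows "(   (A          @\<^sub>c 0\<^sub>m r1 b @\<^sub>c 0\<^sub>m r1 c)
          @\<^sub>r (0\<^sub>m r2 a   @\<^sub>c B        @\<^sub>c 0\<^sub>m r2 c)
          @\<^sub>r (0\<^sub>m r3 a   @\<^sub>c 0\<^sub>m r3 b @\<^sub>c C)
          @\<^sub>r (P          @\<^sub>c (- Q)    @\<^sub>c 0\<^sub>m r4 c)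
          @\<^sub>r (0\<^sub>m r5 a   @\<^sub>c R        @\<^sub>c (- S))) *\<^sub>v (x @\<^sub>v y @\<^sub>v z)
    = A *\<^sub>v x @\<^sub>v B *\<^sub>v y @\<^sub>v C *\<^sub>v z @\<^sub>v (P *\<^sub>v x - Q *\<^sub>v y) @\<^sub>v (R *\<^sub>v y - S *\<^sub>v z)"
proof -
  let ?R1 = "A @\<^sub>c 0\<^sub>m r1 b @\<^sub>c 0\<^sub>m r1 c"
  let ?R2 = "0\<^sub>m r2 a @\<^sub>c B @\<^sub>c 0\<^sub>m r2 c"
  let ?R3 = "0\<^sub>m r3 a @\<^sub>c 0\<^sub>m r3 b @\<^sub>c C"
  let ?R4 = "P @\<^sub>c (- Q) @\<^sub>c 0\<^sub>m r4 c"
  let ?R5 = "0\<^sub>m r5 a @\<^sub>c R @\<^sub>c (- S)"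
  let ?n = "a + (b + c)"
  let ?w = "x @\<^sub>v y @\<^sub>v z"
  have R1: "?R1 \<in> carrier_mat r1 ?n" and R2: "?R2 \<in> carrier_mat r2 ?n"
    and R3: "?R3 \<in> carrier_mat r3 ?n" and R4: "?R4 \<in> carrier_mat r4 ?n"
    and R5: "?R5 \<in> carrier_mat r5 ?n"
    using A B C P Q R S by (intro append_cols_carrier; simp)+
  have w: "?w \<in> carrier_vec ?n"
    using x y z by simp
  have "?R1 *\<^sub>v ?w = A *\<^sub>v x"
    using A x y z by (subst append_cols3_mult_vec[where r = r1]) (auto simp: zero_mat_mult_vec)
  moreover have "?R2 *\<^sub>v ?w = B *\<^sub>v y"
    using B x y z by (subst append_cols3_mult_vec[where r = r2]) (auto simp: zero_mat_mult_vec)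
  moreover have "?R3 *\<^sub>v ?w = C *\<^sub>v z"
    using C x y z by (subst append_cols3_mult_vec[where r = r3]) (auto simp: zero_mat_mult_vec)
  moreover have "?R4 *\<^sub>v ?w = P *\<^sub>v x - Q *\<^sub>v y"
    using P Q x y z by (subst append_cols3_mult_vec[where r = r4]) (auto simp: zero_mat_mult_vec)
  moreover have "?R5 *\<^sub>v ?w = R *\<^sub>v y - S *\<^sub>v z"
    using R S x y z by (subst append_cols3_mult_vec[where r = r5]) (auto simp: zero_mat_mult_vec)
  ultimately show ?thesis
    using mat_mult_append[OF R1 carrier_append_rows[OF R2 carrier_append_rows[OF R3
            carrier_append_rows[OF R4 R5]]] w]
      mat_mult_append[OF R2 carrier_append_rows[OF R3 carrier_append_rows[OF R4 R5]] w]
      mat_mult_append[OF R3 carrier_append_rows[OF R4 R5] w]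
      mat_mult_append[OF R4 R5 w]
    by simp
qed

lemma coupled_rows_carrier:
  fixes A B C P Q R S :: "'a :: comm_ring_1 mat"
  assumes "A \<in> carrier_mat r1 a" "B \<in> carrier_mat r2 b" "C \<in> carrier_mat r3 c"
    and "P \<in> carrier_mat r4 a" "Q \<in> carrier_mat r4 b"
    and "R \<in> carrier_mat r5 b" "S \<in> carrier_mat r5 c"
  shows "(   (A          @\<^sub>c 0\<^sub>m r1 b @\<^sub>c 0\<^sub>m r1 c)
          @\<^sub>r (0\<^sub>m r2 a   @\<^sub>c B        @\<^sub>c 0\<^sub>m r2 c)
          @\<^sub>r (0\<^sub>m r3 a   @\<^sub>c 0\<^sub>m r3 b @\<^sub>c C)
          @\<^sub>r (P          @\<^sub>c (- Q)    @\<^sub>c 0\<^sub>m r4 c)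
          @\<^sub>r (0\<^sub>m r5 a   @\<^sub>c R        @\<^sub>c (- S)))
    \<in> carrier_mat (r1 + r2 + r3 + r4 + r5) (a + b + c)"
  unfolding add.assoc using assms
  by (intro carrier_append_rows append_cols_carrier; simp)

text \<open>If two parametrised points are equal, then the terms that depend on factors can be
  collected on one side, first the continuous and then the binary ones, and the centres on the
  other. This is the form in which a coupling row of the constraints states the equality.\<close>

lemma coupling_of_equal_points:
  fixes p q c p' q' c' :: "'a :: ab_group_add vec"
  assumes eq: "p + q + c = p' + q' + c'"
    and "p \<in> carrier_vec k" "q \<in> carrier_vec k" "c \<in> carrier_vec k"
    and "p' \<in> carrier_vec k" "q' \<in> carrier_vec k" "c' \<in> carrier_vec k"
  shows "(p - p') + (q - q') = c' - c"
proof (rule eq_vecI)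
  fix i assume "i < dim_vec (c' - c)"
  then have "p $ i + q $ i + c $ i = p' $ i + q' $ i + c' $ i"
    using arg_cong[OF eq, of "\<lambda>v. v $ i"] assms(2-) by (auto simp: add.assoc)
  then show "((p - p') + (q - q')) $ i = (c' - c) $ i"
    using \<open>i < dim_vec (c' - c)\<close> assms(2-)
    by (simp add: algebra_simps)
qed (use assms in auto)

section \<open>Hybrid zonotopes\<close>

lemma hybrid_zonotopeE:
  assumes "x \<in> hybrid_zonotope Gc Gb c Ac Ab b" and "hz_carrier d ng nb nc Gc Gb c Ac Ab b"
  obtains \<xi>c \<xi>b where "x = Gc *\<^sub>v \<xi>c + Gb *\<^sub>v \<xi>b + c"
    and "\<xi>c \<in> carrier_vec ng" and "\<forall>i < ng. \<xi>c $ i \<in> {-1..1}"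
    and "\<xi>b \<in> carrier_vec nb" and "\<forall>i < nb. \<xi>b $ i \<in> {-1, 1}"
    and "Ac *\<^sub>v \<xi>c + Ab *\<^sub>v \<xi>b = b"
  using assms unfolding hybrid_zonotope_def hz_carrier_def by auto

lemma hybrid_zonotopeI:
  assumes "hz_carrier d ng nb nc Gc Gb c Ac Ab b"
    and "x = Gc *\<^sub>v \<xi>c + Gb *\<^sub>v \<xi>b + c"
    and "\<xi>c \<in> carrier_vec ng" and "\<forall>i < ng. \<xi>c $ i \<in> {-1..1}"
    and "\<xi>b \<in> carrier_vec nb" and "\<forall>i < nb. \<xi>b $ i \<in> {-1, 1}"
    and "Ac *\<^sub>v \<xi>c + Ab *\<^sub>v \<xi>b = b"
  shows "x \<in> hybrid_zonotope Gc Gb c Ac Ab b"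
  using assms unfolding hybrid_zonotope_def hz_carrier_def by blast

lemma is_hybrid_zonotope_carrier:
  assumes "is_hybrid_zonotope d S" and "x \<in> S"
  shows "x \<in> carrier_vec d"
  using assms unfolding is_hybrid_zonotope_def hz_carrier_def hybrid_zonotope_def by fastforce

lemma all_entries_append3:
  assumes "x \<in> carrier_vec a" "y \<in> carrier_vec b" "z \<in> carrier_vec c"
    and "\<forall>i < a. x $ i \<in> S" "\<forall>i < b. y $ i \<in> S" "\<forall>i < c. z $ i \<in> S"
  shows "\<forall>i < a + b + c. (x @\<^sub>v y @\<^sub>v z) $ i \<in> S"
  using assms by auto

section \<open>The backward reachable set\<close>

theorem theorem1:
  fixes n m :: nat
    and X U T :: "real vec set"
    and f :: "real vec \<Rightarrow> real vec \<Rightarrow> real vec"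
    and \<pi> :: "real vec \<Rightarrow> real vec"
    and l :: nat and W :: "nat \<Rightarrow> real mat" and v :: "nat \<Rightarrow> real vec"
    and ng\<pi> nb\<pi> nc\<pi> ngf nbf ncf ng\<tau> nb\<tau> nc\<tau> :: nat
    and Gc\<pi> Gb\<pi> Ac\<pi> Ab\<pi> Gcf Gbf Acf Abf Gc\<tau> Gb\<tau> Ac\<tau> Ab\<tau> Gcp Gbp Acp Abp :: "real mat"
    and c\<pi> b\<pi> cf bf c\<tau> b\<tau> cp bp :: "real vec"
  assumes X: "is_hybrid_zonotope n X"
    and U: "is_hybrid_zonotope m U"
    and f: "\<forall>x\<in>X. \<forall>u\<in>U. f x u \<in> carrier_vec n"
    and nn: "nn_carrier n m l W v"
    and \<pi>: "\<pi> = nn_output relu l W v"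
    and \<pi>_U: "\<forall>x\<in>X. \<pi> x \<in> U"
    and H\<pi>_carrier: "hz_carrier (n + m) ng\<pi> nb\<pi> nc\<pi> Gc\<pi> Gb\<pi> c\<pi> Ac\<pi> Ab\<pi> b\<pi>"
    and H\<pi>: "hybrid_zonotope Gc\<pi> Gb\<pi> c\<pi> Ac\<pi> Ab\<pi> b\<pi> = controller_graph \<pi> X"
    and Hf_carrier: "hz_carrier (2 * n + m) ngf nbf ncf Gcf Gbf cf Acf Abf bf"
    and Hf: "dynamics_graph f X U \<subseteq> hybrid_zonotope Gcf Gbf cf Acf Abf bf"
    and T_carrier: "hz_carrier n ng\<tau> nb\<tau> nc\<tau> Gc\<tau> Gb\<tau> c\<tau> Ac\<tau> Ab\<tau> b\<tau>"
    and T: "T = hybrid_zonotope Gc\<tau> Gb\<tau> c\<tau> Ac\<tau> Ab\<tau> b\<tau>"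
    and cp: "cp = entries_between 1 n c\<pi>"
    and Gcp: "Gcp = rows_between 1 n Gc\<pi> @\<^sub>c 0\<^sub>m n ngf @\<^sub>c 0\<^sub>m n ng\<tau>"
    and Gbp: "Gbp = rows_between 1 n Gb\<pi> @\<^sub>c 0\<^sub>m n nbf @\<^sub>c 0\<^sub>m n nb\<tau>"
    and Acp: "Acp =
          (Ac\<pi>            @\<^sub>c 0\<^sub>m nc\<pi> ngf                                @\<^sub>c 0\<^sub>m nc\<pi> ng\<tau>)
       @\<^sub>r (0\<^sub>m ncf ng\<pi>    @\<^sub>c Acf                                        @\<^sub>c 0\<^sub>m ncf ng\<tau>)
       @\<^sub>r (0\<^sub>m nc\<tau> ng\<pi>    @\<^sub>c 0\<^sub>m nc\<tau> ngf                                @\<^sub>c Ac\<tau>)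
       @\<^sub>r (Gc\<pi>            @\<^sub>c (- rows_between 1 (n + m) Gcf)               @\<^sub>c 0\<^sub>m (n + m) ng\<tau>)
       @\<^sub>r (0\<^sub>m n ng\<pi>      @\<^sub>c rows_between (n + m + 1) (2 * n + m) Gcf     @\<^sub>c (- Gc\<tau>))"
    and Abp: "Abp =
          (Ab\<pi>            @\<^sub>c 0\<^sub>m nc\<pi> nbf                                @\<^sub>c 0\<^sub>m nc\<pi> nb\<tau>)
       @\<^sub>r (0\<^sub>m ncf nb\<pi>    @\<^sub>c Abf                                        @\<^sub>c 0\<^sub>m ncf nb\<tau>)
       @\<^sub>r (0\<^sub>m nc\<tau> nb\<pi>    @\<^sub>c 0\<^sub>m nc\<tau> nbf                                @\<^sub>c Ab\<tau>)
       @\<^sub>r (Gb\<pi>            @\<^sub>c (- rows_between 1 (n + m) Gbf)               @\<^sub>c 0\<^sub>m (n + m) nb\<tau>)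
       @\<^sub>r (0\<^sub>m n nb\<pi>      @\<^sub>c rows_between (n + m + 1) (2 * n + m) Gbf     @\<^sub>c (- Gb\<tau>))"
    and bp: "bp =
          b\<pi> @\<^sub>v bf @\<^sub>v b\<tau>
       @\<^sub>v (entries_between 1 (n + m) cf - c\<pi>)
       @\<^sub>v (c\<tau> - entries_between (n + m + 1) (2 * n + m) cf)"
  shows "hz_carrier n (ng\<pi> + ngf + ng\<tau>) (nb\<pi> + nbf + nb\<tau>) (nc\<pi> + ncf + nc\<tau> + (n + m) + n)
           Gcp Gbp cp Acp Abp bp
       \<and> backward_reach X f \<pi> T \<subseteq> hybrid_zonotope Gcp Gbp cp Acp Abp bp"
proof
  have Gc\<pi>: "Gc\<pi> \<in> carrier_mat (n + m) ng\<pi>" and Gb\<pi>: "Gb\<pi> \<in> carrier_mat (n + m) nb\<pi>"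
    and c\<pi>: "c\<pi> \<in> carrier_vec (n + m)"
    and Ac\<pi>: "Ac\<pi> \<in> carrier_mat nc\<pi> ng\<pi>" and Ab\<pi>: "Ab\<pi> \<in> carrier_mat nc\<pi> nb\<pi>"
    and b\<pi>: "b\<pi> \<in> carrier_vec nc\<pi>"
    using H\<pi>_carrier by (auto simp: hz_carrier_def)
  have Gcf: "Gcf \<in> carrier_mat (2 * n + m) ngf" and Gbf: "Gbf \<in> carrier_mat (2 * n + m) nbf"
    and cf: "cf \<in> carrier_vec (2 * n + m)"
    and Acf: "Acf \<in> carrier_mat ncf ngf" and Abf: "Abf \<in> carrier_mat ncf nbf"
    and bf: "bf \<in> carrier_vec ncf"
    using Hf_carrier by (auto simp: hz_carrier_def)
  have Gc\<tau>: "Gc\<tau> \<in> carrier_mat n ng\<tau>" and Gb\<tau>: "Gb\<tau> \<in> carrier_mat n nb\<tau>"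
    and c\<tau>: "c\<tau> \<in> carrier_vec n"
    and Ac\<tau>: "Ac\<tau> \<in> carrier_mat nc\<tau> ng\<tau>" and Ab\<tau>: "Ab\<tau> \<in> carrier_mat nc\<tau> nb\<tau>"
    and b\<tau>: "b\<tau> \<in> carrier_vec nc\<tau>"
    using T_carrier by (auto simp: hz_carrier_def)
  \<comment> \<open>The slices of the envelope that carry the coordinates \<open>(x, u)\<close> and \<open>y\<close>.\<close>
  define Fc Fb c1 where "Fc = rows_between 1 (n + m) Gcf" and "Fb = rows_between 1 (n + m) Gbf"
    and "c1 = entries_between 1 (n + m) cf"
  define Yc Yb c2 where "Yc = rows_between (n + m + 1) (2 * n + m) Gcf"
    and "Yb = rows_between (n + m + 1) (2 * n + m) Gbf"
    and "c2 = entries_between (n + m + 1) (2 * n + m) cf"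
  have Fc: "Fc \<in> carrier_mat (n + m) ngf" and Fb: "Fb \<in> carrier_mat (n + m) nbf"
    and c1: "c1 \<in> carrier_vec (n + m)"
    using Gcf Gbf by (auto simp: Fc_def Fb_def c1_def rows_between_def entries_between_def)
  have Yc: "Yc \<in> carrier_mat n ngf" and Yb: "Yb \<in> carrier_mat n nbf" and c2: "c2 \<in> carrier_vec n"
    using Gcf Gbf by (auto simp: Yc_def Yb_def c2_def rows_between_def entries_between_def)
  have Xc: "rows_between 1 n Gc\<pi> \<in> carrier_mat n ng\<pi>"
    and Xb: "rows_between 1 n Gb\<pi> \<in> carrier_mat n nb\<pi>"
    using Gc\<pi> Gb\<pi> by (auto simp: rows_between_def)

  have "Gcp \<in> carrier_mat n (ng\<pi> + ngf + ng\<tau>)" and "Gbp \<in> carrier_mat n (nb\<pi> + nbf + nb\<tau>)"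
    unfolding Gcp Gbp add.assoc by (intro append_cols_carrier; (fact Xc Xb | simp))+
  moreover have "cp \<in> carrier_vec n"
    by (simp add: cp entries_between_def)
  moreover have "Acp \<in> carrier_mat (nc\<pi> + ncf + nc\<tau> + (n + m) + n) (ng\<pi> + ngf + ng\<tau>)"
    unfolding Acp Fc_def[symmetric] Yc_def[symmetric]
    by (rule coupled_rows_carrier[OF Ac\<pi> Acf Ac\<tau> Gc\<pi> Fc Yc Gc\<tau>])
  moreover have "Abp \<in> carrier_mat (nc\<pi> + ncf + nc\<tau> + (n + m) + n) (nb\<pi> + nbf + nb\<tau>)"
    unfolding Abp Fb_def[symmetric] Yb_def[symmetric]
    by (rule coupled_rows_carrier[OF Ab\<pi> Abf Ab\<tau> Gb\<pi> Fb Yb Gb\<tau>])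
  moreover have "bp \<in> carrier_vec (nc\<pi> + ncf + nc\<tau> + (n + m) + n)"
    unfolding bp c1_def[symmetric] c2_def[symmetric] using b\<pi> bf b\<tau> c\<pi> c2
    by (intro carrier_vecI) simp
  ultimately show carrier: "hz_carrier n (ng\<pi> + ngf + ng\<tau>) (nb\<pi> + nbf + nb\<tau>)
      (nc\<pi> + ncf + nc\<tau> + (n + m) + n) Gcp Gbp cp Acp Abp bp"
    by (simp add: hz_carrier_def)

  show "backward_reach X f \<pi> T \<subseteq> hybrid_zonotope Gcp Gbp cp Acp Abp bp"
  proof
    fix x assume "x \<in> backward_reach X f \<pi> T"
    then have xX: "x \<in> X" and yT: "f x (\<pi> x) \<in> T"
      by (auto simp: backward_reach_def)
    define u y where "u = \<pi> x" and "y = f x u"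
    have uU: "u \<in> U" using \<pi>_U xX by (simp add: u_def)
    have x: "x \<in> carrier_vec n" and u: "u \<in> carrier_vec m" and y: "y \<in> carrier_vec n"
      using is_hybrid_zonotope_carrier X U xX uU f by (auto simp: y_def)
    then have xu: "x @\<^sub>v u \<in> carrier_vec (n + m)" by simp

    have "x @\<^sub>v u \<in> hybrid_zonotope Gc\<pi> Gb\<pi> c\<pi> Ac\<pi> Ab\<pi> b\<pi>"
      unfolding H\<pi> controller_graph_def using xX by (auto simp: u_def)
    then obtain \<alpha>c \<alpha>b where xu_eq: "x @\<^sub>v u = Gc\<pi> *\<^sub>v \<alpha>c + Gb\<pi> *\<^sub>v \<alpha>b + c\<pi>"
      and \<alpha>c: "\<alpha>c \<in> carrier_vec ng\<pi>" "\<forall>i < ng\<pi>. \<alpha>c $ i \<in> {-1..1}"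
      and \<alpha>b: "\<alpha>b \<in> carrier_vec nb\<pi>" "\<forall>i < nb\<pi>. \<alpha>b $ i \<in> {-1, 1}"
      and \<alpha>_eq: "Ac\<pi> *\<^sub>v \<alpha>c + Ab\<pi> *\<^sub>v \<alpha>b = b\<pi>"
      using H\<pi>_carrier by (rule hybrid_zonotopeE)
    have "x @\<^sub>v u @\<^sub>v y \<in> dynamics_graph f X U"
      unfolding dynamics_graph_def using xX uU y_def by blast
    with Hf have "x @\<^sub>v u @\<^sub>v y \<in> hybrid_zonotope Gcf Gbf cf Acf Abf bf" by blast
    then obtain \<beta>c \<beta>b where xuy_eq: "x @\<^sub>v u @\<^sub>v y = Gcf *\<^sub>v \<beta>c + Gbf *\<^sub>v \<beta>b + cf"
      and \<beta>c: "\<beta>c \<in> carrier_vec ngf" "\<forall>i < ngf. \<beta>c $ i \<in> {-1..1}"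
      and \<beta>b: "\<beta>b \<in> carrier_vec nbf" "\<forall>i < nbf. \<beta>b $ i \<in> {-1, 1}"
      and \<beta>_eq: "Acf *\<^sub>v \<beta>c + Abf *\<^sub>v \<beta>b = bf"
      using Hf_carrier by (rule hybrid_zonotopeE)
    have "y \<in> hybrid_zonotope Gc\<tau> Gb\<tau> c\<tau> Ac\<tau> Ab\<tau> b\<tau>"
      using yT T by (simp add: y_def u_def)
    then obtain \<gamma>c \<gamma>b where y_eq: "y = Gc\<tau> *\<^sub>v \<gamma>c + Gb\<tau> *\<^sub>v \<gamma>b + c\<tau>"
      and \<gamma>c: "\<gamma>c \<in> carrier_vec ng\<tau>" "\<forall>i < ng\<tau>. \<gamma>c $ i \<in> {-1..1}"
      and \<gamma>b: "\<gamma>b \<in> carrier_vec nb\<tau>" "\<forall>i < nb\<tau>. \<gamma>b $ i \<in> {-1, 1}"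
      and \<gamma>_eq: "Ac\<tau> *\<^sub>v \<gamma>c + Ab\<tau> *\<^sub>v \<gamma>b = b\<tau>"
      using T_carrier by (rule hybrid_zonotopeE)

    have "x @\<^sub>v u = entries_between 1 (n + m) (x @\<^sub>v u @\<^sub>v y)"
      using entries_between_append_left[OF xu, of y] by (simp add: append_vec_assoc)
    then have xu_env: "x @\<^sub>v u = Fc *\<^sub>v \<beta>c + Fb *\<^sub>v \<beta>b + c1"
      unfolding xuy_eq Fc_def Fb_def c1_def
      using entries_between_affine[OF Gcf Gbf cf, of 1 "n + m"] by simp
    have "y = entries_between (n + m + 1) (2 * n + m) (x @\<^sub>v u @\<^sub>v y)"
      using entries_between_append_right[OF xu y] by (simp add: append_vec_assoc mult_2 add.assoc)
    then have y_env: "y = Yc *\<^sub>v \<beta>c + Yb *\<^sub>v \<beta>b + c2"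
      unfolding xuy_eq Yc_def Yb_def c2_def
      using entries_between_affine[OF Gcf Gbf cf, of "n + m + 1" "2 * n + m"] by simp

    have couple_xu: "(Gc\<pi> *\<^sub>v \<alpha>c - Fc *\<^sub>v \<beta>c) + (Gb\<pi> *\<^sub>v \<alpha>b - Fb *\<^sub>v \<beta>b) = c1 - c\<pi>"
      by (rule coupling_of_equal_points[where k = "n + m"])
        (use xu_eq xu_env Gc\<pi> Gb\<pi> c\<pi> Fc Fb c1 \<alpha>c \<alpha>b \<beta>c \<beta>b in auto)
    have couple_y: "(Yc *\<^sub>v \<beta>c - Gc\<tau> *\<^sub>v \<gamma>c) + (Yb *\<^sub>v \<beta>b - Gb\<tau> *\<^sub>v \<gamma>b) = c\<tau> - c2"
      by (rule coupling_of_equal_points[where k = n])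
        (use y_eq y_env Gc\<tau> Gb\<tau> c\<tau> Yc Yb c2 \<gamma>c \<gamma>b \<beta>c \<beta>b in auto)

    let ?\<xi>c = "\<alpha>c @\<^sub>v \<beta>c @\<^sub>v \<gamma>c"
    let ?\<xi>b = "\<alpha>b @\<^sub>v \<beta>b @\<^sub>v \<gamma>b"
    show "x \<in> hybrid_zonotope Gcp Gbp cp Acp Abp bp"
    proof (rule hybrid_zonotopeI[OF carrier])
      have "Gcp *\<^sub>v ?\<xi>c = rows_between 1 n Gc\<pi> *\<^sub>v \<alpha>c"
        unfolding Gcp using Xc \<alpha>c \<beta>c \<gamma>c
        by (subst append_cols3_mult_vec[where r = n]) (auto simp: zero_mat_mult_vec)
      moreover have "Gbp *\<^sub>v ?\<xi>b = rows_between 1 n Gb\<pi> *\<^sub>v \<alpha>b"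
        unfolding Gbp using Xb \<alpha>b \<beta>b \<gamma>b
        by (subst append_cols3_mult_vec[where r = n]) (auto simp: zero_mat_mult_vec)
      moreover have "x = rows_between 1 n Gc\<pi> *\<^sub>v \<alpha>c + rows_between 1 n Gb\<pi> *\<^sub>v \<alpha>b + cp"
        using entries_between_append_left[OF x, of u]
          entries_between_affine[OF Gc\<pi> Gb\<pi> c\<pi>, of 1 n \<alpha>c \<alpha>b]
        by (simp add: xu_eq cp)
      ultimately show "x = Gcp *\<^sub>v ?\<xi>c + Gbp *\<^sub>v ?\<xi>b + cp"
        by simp
      show "?\<xi>c \<in> carrier_vec (ng\<pi> + ngf + ng\<tau>)"
        unfolding add.assoc using \<alpha>c \<beta>c \<gamma>c by simp
      show "?\<xi>b \<in> carrier_vec (nb\<pi> + nbf + nb\<tau>)"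
        unfolding add.assoc using \<alpha>b \<beta>b \<gamma>b by simp
      show "\<forall>i < ng\<pi> + ngf + ng\<tau>. ?\<xi>c $ i \<in> {-1..1}"
        by (rule all_entries_append3) (fact \<alpha>c \<beta>c \<gamma>c)+
      show "\<forall>i < nb\<pi> + nbf + nb\<tau>. ?\<xi>b $ i \<in> {-1, 1}"
        by (rule all_entries_append3) (fact \<alpha>b \<beta>b \<gamma>b)+
      have "Acp *\<^sub>v ?\<xi>c = Ac\<pi> *\<^sub>v \<alpha>c @\<^sub>v Acf *\<^sub>v \<beta>c @\<^sub>v Ac\<tau> *\<^sub>v \<gamma>c
          @\<^sub>v (Gc\<pi> *\<^sub>v \<alpha>c - Fc *\<^sub>v \<beta>c) @\<^sub>v (Yc *\<^sub>v \<beta>c - Gc\<tau> *\<^sub>v \<gamma>c)"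
        unfolding Acp Fc_def[symmetric] Yc_def[symmetric]
        by (rule coupled_rows_mult_vec[OF Ac\<pi> Acf Ac\<tau> Gc\<pi> Fc Yc Gc\<tau> \<alpha>c(1) \<beta>c(1) \<gamma>c(1)])
      moreover have "Abp *\<^sub>v ?\<xi>b = Ab\<pi> *\<^sub>v \<alpha>b @\<^sub>v Abf *\<^sub>v \<beta>b @\<^sub>v Ab\<tau> *\<^sub>v \<gamma>b
          @\<^sub>v (Gb\<pi> *\<^sub>v \<alpha>b - Fb *\<^sub>v \<beta>b) @\<^sub>v (Yb *\<^sub>v \<beta>b - Gb\<tau> *\<^sub>v \<gamma>b)"
        unfolding Abp Fb_def[symmetric] Yb_def[symmetric]
        by (rule coupled_rows_mult_vec[OF Ab\<pi> Abf Ab\<tau> Gb\<pi> Fb Yb Gb\<tau> \<alpha>b(1) \<beta>b(1) \<gamma>b(1)])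
      ultimately have "Acp *\<^sub>v ?\<xi>c + Abp *\<^sub>v ?\<xi>b =
          (Ac\<pi> *\<^sub>v \<alpha>c + Ab\<pi> *\<^sub>v \<alpha>b) @\<^sub>v (Acf *\<^sub>v \<beta>c + Abf *\<^sub>v \<beta>b) @\<^sub>v (Ac\<tau> *\<^sub>v \<gamma>c + Ab\<tau> *\<^sub>v \<gamma>b)
          @\<^sub>v ((Gc\<pi> *\<^sub>v \<alpha>c - Fc *\<^sub>v \<beta>c) + (Gb\<pi> *\<^sub>v \<alpha>b - Fb *\<^sub>v \<beta>b))
          @\<^sub>v ((Yc *\<^sub>v \<beta>c - Gc\<tau> *\<^sub>v \<gamma>c) + (Yb *\<^sub>v \<beta>b - Gb\<tau> *\<^sub>v \<gamma>b))"
        using Ac\<pi> Ab\<pi> Acf Abf Ac\<tau> Ab\<tau> Gc\<pi> Gb\<pi> Fc Fb Yc Yb Gc\<tau> Gb\<tau>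
        by (simp only:) (intro append_vec_add5; auto)
      then show "Acp *\<^sub>v ?\<xi>c + Abp *\<^sub>v ?\<xi>b = bp"
        unfolding bp c1_def[symmetric] c2_def[symmetric]
        by (simp only: \<alpha>_eq \<beta>_eq \<gamma>_eq couple_xu couple_y)
    qed
  qed
qed

end
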